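(* Consider the forest fire model on $\mathbb{Z}_+$ with burning time distribution $\theta\ge 0$ and spreading time distribution $\Delta\ge 0$, and suppose that $\mathbb{P}(\Delta>0)>0$. Then almost surely there is an infinite fire, i.e. $\mathbb{P}\left(\inf\{k\ge 1:\ n_k=\infty\}<\infty\right)=1$, where $n_k$ is the right-most site burnt by the $k$-th fire.
   Context: Forest fire model on $\mathbb{Z}_+=\{0,1,2,\dots\}$. Let $\theta$ and $\Delta$ be non-negative (finite-valued) random variables. Each site is either vacant, occupied by a non-burning tree, or occupied by a burning tree. All sites are vacant at time $0$. Let $\theta_{x,i}$ ($x\ge 0$, $i\ge1$) be i.i.d. copies of $\theta$, and $\Delta_{x,i}$ be i.i.d. copies of $\Delta$; these families and all tree-appearance clocks are independent. (1) At each vacant non-burning site a tree appears at rate $1$ (after an $\exp(1)$ time, independent of everything else). (2) There is a constant source of fire at site $0$: a tree appearing at $0$ starts burning immediately. (3) If the tree at $x$ starts burning for the $i$-th time at time $f_{x,i}$, it burns during a time $\theta_{x,i}$, i.e. during $[f_{x,i},f_{x,i}+\theta_{x,i}]$, after which $x$ is vacant. (4) Spread of fire: let $t=f_{x,i}$. If at time $t+\Delta_{x,i}$ there is a non-burning tree at $x+1$, it starts burning at time $t+\Delta_{x,i}$. Otherwise, if the next tree at $x+1$ appears at time $t+\Delta_{x,i}+\nu$, $\nu>0$, then it starts burning immediately at that time if $\nu<\theta_{x,i}$, while if $\nu\ge\theta_{x,i}$ this fire does not propagate beyond $x$. (The tree at $x$ may already have burnt out before $x+1$ catches fire.) If the time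 $\tilde t=f_{x,i}+\theta_{x,i}+\Delta_{x,i}$ exceeds $f_{x,i+1}+\Delta_{x,i+1}$, then the $(i+1)$-st burning of $x$ can ignite $x+1$ only after time $\tilde t$. (5) While a site is burning, no tree can grow there and no fire from the left neighbour can spread to it; after burning, a new tree appears after an independent $\exp(1)$ time. The $k$-th fire is the one started by the $k$-th burning of site $0$, together with all burnings successively ignited by it through spreading to the right; $n_k\in\{0,1,2,\dots\}\cup\{\infty\}$ is the right-most site burnt by the $k$-th fire. The $k$-th fire is infinite if $n_k=\infty$, i.e. it never stops but continues to infinity. *)

theory Defs
  imports "HOL-Probability.Probability" "HOL-Library.Extended_Nat"
begin

section \<open>The dynamics for given clocks\<close>

text \<open>
  Let \<open>x\<close> be a site. \<open>\<theta> x i\<close> is the duration of the \<open>i\<close>-th burning of \<open>x\<close>, \<open>\<Delta> x i\<close> is the time the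
  fire needs to get from the \<open>i\<close>-th burning of \<open>x\<close> to \<open>x + 1\<close>, and \<open>\<xi> x i\<close> is the time which the
  \<open>i\<close>-th tree at \<open>x\<close> needs to appear, counted from time \<open>0\<close> (for \<open>i = 1\<close>) or from the end of the
  burning number \<open>i - 1\<close> of \<open>x\<close> (for \<open>i > 1\<close>). The index \<open>i\<close> starts from \<open>1\<close>; \<open>i = 0\<close> is never used.

  The \<open>i\<close>-th burning of \<open>x\<close>, started at time \<open>t\<close>, can ignite \<open>x + 1\<close> at the time \<open>t + \<Delta> x i\<close> and
  at the times in \<open>[t + \<Delta> x i, t + \<Delta> x i + \<theta> x i)\<close>, but not before
  the corresponding times \<open>t' + \<theta> x j + \<Delta> x j\<close> of the preceding burnings \<open>j < i\<close> of \<open>x\<close>, and it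
  ignites at most one tree at \<open>x + 1\<close>. Hence every burning of \<open>x + 1\<close> is ignited by exactly one
  burning of \<open>x\<close>, and fires do not overtake each other: every site is visited by the fires that
  reach it in the order of their numbers. So the burnings of a site can be enumerated by
  the number \<open>k \<ge> 1\<close> of the fire, and the burning of \<open>x\<close> by fire \<open>k\<close> is the burning
  of \<open>x\<close> with number \<open>i = burnings x k\<close>:

  \<^item> \<open>ignition x k\<close>: the time at which fire \<open>k\<close> ignites \<open>x\<close>; \<open>None\<close> if it does not reach \<open>x\<close>;
  \<^item> \<open>burnings x k\<close>: the number of burnings of \<open>x\<close> due to the fires \<open>1, \<dots>, k\<close>;
  \<^item> \<open>next_tree x k\<close>: the time of appearance of the first tree at \<open>x\<close> that is not burnt by one of the
    fires \<open>1, \<dots>, k\<close>;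
  \<^item> \<open>released x k\<close>: the latest of the times \<open>f + \<theta> x i + \<Delta> x i\<close> over the burnings \<open>i\<close> of \<open>x\<close>
    due to the fires \<open>1, \<dots>, k\<close>, where \<open>f\<close> is the start of the burning \<open>i\<close>.
\<close>

context
  fixes \<theta> \<Delta> \<xi> :: "nat \<Rightarrow> nat \<Rightarrow> real"
begin

text \<open>
  In the equation for \<open>ignition (Suc x) (Suc k)\<close>, \<open>s\<close> is the first time not before \<open>a\<close> at which
  there is a non-burning tree at \<open>x + 1\<close> and the earlier burnings of \<open>x\<close> have released \<open>x + 1\<close>.
  The case \<open>s = a\<close> matters if \<open>\<theta> x i = 0\<close>: a tree which is present at time \<open>a\<close> is
  ignited in any case, whereas one that appears at \<open>a + \<nu>\<close>, \<open>\<nu> > 0\<close>, is ignited only if \<open>\<nu> < \<theta> x i\<close>.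
\<close>

fun ignition :: "nat \<Rightarrow> nat \<Rightarrow> real option"
  and burnings :: "nat \<Rightarrow> nat \<Rightarrow> nat"
  and next_tree :: "nat \<Rightarrow> nat \<Rightarrow> real"
  and released :: "nat \<Rightarrow> nat \<Rightarrow> real"
where
  "ignition x 0 = None"
| "ignition 0 (Suc k) = Some (next_tree 0 k)"
| "ignition (Suc x) (Suc k) =
     (case ignition x (Suc k) of
        None \<Rightarrow> None
      | Some t \<Rightarrow>
          (let i = burnings x (Suc k);
               a = t + \<Delta> x i;
               s = max a (max (released x k) (next_tree (Suc x) k))
           in if s = a \<or> s < a + \<theta> x i then Some s else None))"
| "burnings x 0 = 0"
| "burnings x (Suc k) =
     (case ignition x (Suc k) of
        None \<Rightarrow> burnings x k
      | Some t \<Rightarrow> Suc (burnings x k))"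
| "next_tree x 0 = \<xi> x 1"
| "next_tree x (Suc k) =
     (case ignition x (Suc k) of
        None \<Rightarrow> next_tree x k
      | Some t \<Rightarrow> (let i = burnings x (Suc k) in t + \<theta> x i + \<xi> x (Suc i)))"
| "released x 0 = 0"
| "released x (Suc k) =
     (case ignition x (Suc k) of
        None \<Rightarrow> released x k
      | Some t \<Rightarrow> (let i = burnings x (Suc k) in max (released x k) (t + \<theta> x i + \<Delta> x i)))"

text \<open>
  The right-most site burnt by fire \<open>k\<close>; the value is \<open>\<infinity>\<close> iff the fire reaches every site.
\<close>

definition rightmost_burnt :: "nat \<Rightarrow> enat" where
  "rightmost_burnt k = (SUP x\<in>{x. ignition x k \<noteq> None}. enat x)"

end

section \<open>The random clocks\<close>

datatype clock_kind = Burning | Spreading | Growing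

text \<open>
  \<open>\<theta>\<close> and \<open>\<Delta>\<close> are the generic burning and spreading times, living on an arbitrary probability space
  \<open>N\<close>; \<open>\<theta>s x i\<close> and \<open>\<Delta>s x i\<close> are their i.i.d. copies and \<open>\<xi>s x i\<close> the \<open>exp(1)\<close> times.
\<close>

locale forest_fire = prob_space M
  for M :: "'a measure" +
  fixes N :: "'b measure"
    and \<theta> \<Delta> :: "'b \<Rightarrow> real"
    and \<theta>s \<Delta>s \<xi>s :: "nat \<Rightarrow> nat \<Rightarrow> 'a \<Rightarrow> real"
  assumes N: "prob_space N"
    and \<theta>_measurable: "\<theta> \<in> borel_measurable N"
    and \<theta>_nonneg: "AE \<omega> in N. 0 \<le> \<theta> \<omega>"
    and \<Delta>_measurable: "\<Delta> \<in> borel_measurable N"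
    and \<Delta>_nonneg: "AE \<omega> in N. 0 \<le> \<Delta> \<omega>"
    and indep:
      "indep_vars (\<lambda>_. borel)
         (\<lambda>(c, x, i). case c of Burning \<Rightarrow> \<theta>s x i | Spreading \<Rightarrow> \<Delta>s x i | Growing \<Rightarrow> \<xi>s x i)
         (UNIV \<times> UNIV \<times> {1..})"
    and \<theta>s_distr: "\<And>x i. 1 \<le> i \<Longrightarrow> distr M borel (\<theta>s x i) = distr N borel \<theta>"
    and \<Delta>s_distr: "\<And>x i. 1 \<le> i \<Longrightarrow> distr M borel (\<Delta>s x i) = distr N borel \<Delta>"
    and \<xi>s_distr: "\<And>x i. 1 \<le> i \<Longrightarrow> distributed M lborel (\<xi>s x i) (exponential_density 1)"

end

theory Submission
  imports Defs "HOL-Real_Asymp.Real_Asymp" "HOL-Library.Discrete_Functions"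
begin

text \<open>
  Every site \<open>x\<close> burns infinitely often: after the last burning of \<open>x\<close> a tree would be waiting there,
  and it would be ignited by a late burning of \<open>x - 1\<close> whose release time exceeds all earlier ones.
  So it is enough that, for all large \<open>x\<close>, the first fire that reaches \<open>x\<close> finds a tree at \<open>x + 1\<close>:
  it is then also the first fire to reach \<open>x + 1\<close>, and so on forever. The tree is there if the fire
  arrives after time \<open>\<xi> (x + 1) 1\<close>. Put \<open>L = \<lfloor>\<surd>x\<rfloor>\<close>. Since fires are delayed on their way,
  Chernoff bounds show that no fire reaches \<open>x\<close> before time \<open>c L\<close>, up to an event of probability
  \<open>O(L\<^sup>2 exp (- c L))\<close>, while \<open>\<xi> (x + 1) 1 > c L\<close> has probability \<open>exp (- c L)\<close>. Borel-Cantelli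
  over \<open>L\<close> concludes.
\<close>

section \<open>Dynamics with non-negative clocks\<close>

lemma ignition_SucE:
  assumes "ignition \<theta> \<Delta> \<xi> (Suc x) k = Some t"
  obtains t' where "ignition \<theta> \<Delta> \<xi> x k = Some t'"
    and "t' + \<Delta> x (burnings \<theta> \<Delta> \<xi> x k) \<le> t"
  using assms by (cases k) (auto simp: Let_def split: option.splits if_splits)

lemma ignition_downward:
  assumes "ignition \<theta> \<Delta> \<xi> x k \<noteq> None" "y \<le> x"
  shows "ignition \<theta> \<Delta> \<xi> y k \<noteq> None"
  using assms(2,1)
proof (induction rule: inc_induct)
  case (step n)
  then show ?case by (metis ignition_SucE option.exhaust option.distinct(1))
qed

text \<open>Every fire counted at \<open>Suc x\<close> has passed through \<open>x\<close>, so it is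
  counted there too.\<close>

lemma burnings_Suc_le: "burnings \<theta> \<Delta> \<xi> (Suc x) k \<le> burnings \<theta> \<Delta> \<xi> x k"
proof (induction k)
  case (Suc k)
  then show ?case
    using ignition_downward[of \<theta> \<Delta> \<xi> "Suc x" "Suc k" x]
    by (cases "ignition \<theta> \<Delta> \<xi> (Suc x) (Suc k)"; cases "ignition \<theta> \<Delta> \<xi> x (Suc k)")
      (simp_all del: ignition.simps)
qed simp

lemma mono_burnings: "mono (burnings \<theta> \<Delta> \<xi> x)"
  by (rule mono_iff_le_Suc[THEN iffD2]) (auto split: option.splits simp del: ignition.simps)

lemma burnings_0: "burnings \<theta> \<Delta> \<xi> 0 k = k"
  by (induction k) auto

lemma burnings_pos: "ignition \<theta> \<Delta> \<xi> x k \<noteq> None \<Longrightarrow> 1 \<le> burnings \<theta> \<Delta> \<xi> x k"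
  by (cases k) (auto split: option.splits simp del: ignition.simps(2,3))

lemma next_tree_le_ignition:
  "ignition \<theta> \<Delta> \<xi> x (Suc k) = Some t \<Longrightarrow> next_tree \<theta> \<Delta> \<xi> x k \<le> t"
  by (cases x) (auto simp: Let_def split: option.splits if_splits)

text \<open>The sites visited by a fire form an initial segment, so an unbounded set of visited
  sites contains every site.\<close>

lemma rightmost_burnt_eq_infinity_iff:
  "rightmost_burnt \<theta> \<Delta> \<xi> k = \<infinity> \<longleftrightarrow> (\<forall>x. ignition \<theta> \<Delta> \<xi> x k \<noteq> None)"
proof
  assume *: "rightmost_burnt \<theta> \<Delta> \<xi> k = \<infinity>"
  show "\<forall>x. ignition \<theta> \<Delta> \<xi> x k \<noteq> None"
  proof
    fix x
    have "enat x < (SUP y\<in>{y. ignition \<theta> \<Delta> \<xi> y k \<noteq> None}. enat y)"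
      using * by (simp add: rightmost_burnt_def)
    then obtain y where "ignition \<theta> \<Delta> \<xi> y k \<noteq> None" "x < y"
      by (auto simp: less_SUP_iff)
    then show "ignition \<theta> \<Delta> \<xi> x k \<noteq> None"
      using ignition_downward[of \<theta> \<Delta> \<xi> y k x] by simp
  qed
next
  assume "\<forall>x. ignition \<theta> \<Delta> \<xi> x k \<noteq> None"
  then have eq: "rightmost_burnt \<theta> \<Delta> \<xi> k = (SUP x. enat x)"
    by (simp add: rightmost_burnt_def)
  have "enat m \<le> rightmost_burnt \<theta> \<Delta> \<xi> k" for m
    unfolding eq by (rule SUP_upper) simp
  then show "rightmost_burnt \<theta> \<Delta> \<xi> k = \<infinity>"
    by (metis Suc_n_not_le_n enat.exhaust enat_ord_simps(1) not_infinity_eq)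
qed

text \<open>Pigeonhole: \<open>L\<close> strict decreases in a row, starting from at most
  \<open>L\<close>, would end at 0.\<close>

lemma antitone_has_repeat:
  fixes f :: "nat \<Rightarrow> nat"
  assumes anti: "\<And>j. f (Suc j) \<le> f j" and "f 0 \<le> L" "0 < f L"
  shows "\<exists>j<L. f (Suc j) = f j"
proof (rule ccontr)
  assume "\<not> ?thesis"
  then have lt: "f (Suc j) < f j" if "j < L" for j using anti[of j] that by (metis le_neq_implies_less)
  have "j \<le> L \<Longrightarrow> f j + j \<le> f 0" for j
  proof (induction j)
    case (Suc j)
    then show ?case using lt[of j] by simp
  qed simp
  from this[of L] assms show False by simp
qed

section \<open>Deterministic bounds on ignition times, recurrence of burnings, and survival of a
  first fire\<close>

locale nonneg_clocks =
  fixes \<theta> \<Delta> \<xi> :: "nat \<Rightarrow> nat \<Rightarrow> real"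
  assumes \<theta>_nonneg: "1 \<le> i \<Longrightarrow> 0 \<le> \<theta> x i"
    and \<Delta>_nonneg: "1 \<le> i \<Longrightarrow> 0 \<le> \<Delta> x i"
    and \<xi>_nonneg: "1 \<le> i \<Longrightarrow> 0 \<le> \<xi> x i"
begin

abbreviation "ign \<equiv> ignition \<theta> \<Delta> \<xi>"
abbreviation "burn \<equiv> burnings \<theta> \<Delta> \<xi>"
abbreviation "tree \<equiv> next_tree \<theta> \<Delta> \<xi>"
abbreviation "rel \<equiv> released \<theta> \<Delta> \<xi>"

text \<open>Trees at one site grow one after the other, each only after the previous one has burnt.
  Waiting and burning times in between are dropped.\<close>

lemma sum_\<xi>_le_next_tree: "(\<Sum>i=1..Suc (burn x k). \<xi> x i) \<le> tree x k"
proof (induction k)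
  case (Suc k)
  show ?case
  proof (cases "ign x (Suc k)")
    case (Some t)
    have "tree x k \<le> t" "0 \<le> \<theta> x (Suc (burn x k))"
      using next_tree_le_ignition[OF Some] by (auto intro: \<theta>_nonneg)
    with Suc Some show ?thesis by (simp del: ignition.simps)
  qed (use Suc in \<open>simp del: ignition.simps\<close>)
qed simp

lemma sum_\<xi>_le_ignition:
  assumes "ign x k = Some t" "n \<le> burn x k"
  shows "(\<Sum>i=1..n. \<xi> x i) \<le> t"
proof -
  from assms(1) obtain k' where k: "k = Suc k'" by (cases k) auto
  have "burn x k = Suc (burn x k')" using assms(1) by (simp add: k del: ignition.simps)
  then have "(\<Sum>i=1..n. \<xi> x i) \<le> (\<Sum>i=1..Suc (burn x k'). \<xi> x i)"
    using assms(2) by (intro sum_mono2) (auto intro: \<xi>_nonneg)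
  also have "\<dots> \<le> tree x k'" by (rule sum_\<xi>_le_next_tree)
  also have "\<dots> \<le> t" using next_tree_le_ignition assms(1) k by metis
  finally show ?thesis .
qed

lemma ignition_nonneg: "ign x k = Some t \<Longrightarrow> 0 \<le> t"
  using sum_\<xi>_le_ignition[of x k t 0] by simp

text \<open>The delays along the route of fire \<open>k\<close> add up. The second index
  \<open>burn y k\<close> is random in the application, which is why \<open>ignition_late\<close>
  needs its block argument.\<close>

lemma sum_\<Delta>_le_ignition:
  "ign x k = Some t \<Longrightarrow> (\<Sum>y<x. \<Delta> y (burn y k)) \<le> t"
proof (induction x arbitrary: t)
  case (Suc x)
  from Suc.prems obtain t' where "ign x k = Some t'" "t' + \<Delta> x (burn x k) \<le> t"
    by (rule ignition_SucE)
  with Suc.IH[of t'] show ?case by simp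
qed (simp add: ignition_nonneg)

lemma ignition_0_le:
  "ign x k = Some t \<Longrightarrow> \<exists>t0\<le>t. ign 0 k = Some t0"
proof (induction x arbitrary: t)
  case (Suc x)
  from Suc.prems obtain t' where t': "ign x k = Some t'" "t' + \<Delta> x (burn x k) \<le> t"
    by (rule ignition_SucE)
  have "0 \<le> \<Delta> x (burn x k)" using burnings_pos[of \<theta> \<Delta> \<xi> x k] t'(1) by (intro \<Delta>_nonneg) simp
  with t' Suc.IH[of t'] show ?case by fastforce
qed simp

text \<open>Divergence of the growth times makes the burnings of \<open>x\<close> start arbitrarily
  late, which eventually forces one of them to ignite the tree left at \<open>Suc x\<close>.\<close>

lemma burnings_unbounded_Suc:
  assumes div: "\<And>C. \<exists>n. C < (\<Sum>i=1..n. \<xi> x i)"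
    and unb: "\<And>n. \<exists>k. n \<le> burn x k"
  shows "\<exists>k>K. ign (Suc x) k \<noteq> None"
proof (rule ccontr)
  assume "\<not> ?thesis"
  then have none: "ign (Suc x) k = None" if "k > K" for k using that by auto
  define C where "C = max (rel x K) (tree (Suc x) K)"
  have tree: "tree (Suc x) k = tree (Suc x) K" if "k \<ge> K" for k
    using that
  proof (induction rule: dec_induct)
    case (step m)
    then show ?case using none[of "Suc m"] by (simp del: ignition.simps)
  qed simp
  txt \<open>\<open>C\<close> bounds the release times of the fires up to \<open>K\<close> and the appearance of the tree waiting at
    \<open>x + 1\<close>, so the first later burning of \<open>x\<close> with release time above \<open>C\<close> is not blocked by any
    predecessor.\<close>
  define good where "good k \<longleftrightarrow> k > K \<and>
    (\<exists>t. ign x k = Some t \<and> C < t + \<theta> x (burn x k) + \<Delta> x (burn x k))" for k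
  have "\<exists>k. good k"
  proof -
    from div obtain n0 where n0: "C < (\<Sum>i=1..n0. \<xi> x i)" by blast
    \<comment> \<open>\<open>n0\<close> pushes the ignition time beyond \<open>C\<close>;
      \<open>Suc (burn x K)\<close> makes the fire number exceed \<open>K\<close>.\<close>
    define n where "n = max n0 (Suc (burn x K))"
    define k where "k = (LEAST k. n \<le> burn x k)"
    have k: "n \<le> burn x k" unfolding k_def using unb by (rule LeastI_ex)
    have least: "burn x j < n" if "j < k" for j using not_less_Least that unfolding k_def by force
    obtain k' where k': "k = Suc k'" using k by (cases k) (auto simp: n_def)
    have "burn x k' < n" using least[of k'] k' by simp
    \<comment> \<open>The count jumps at the least \<open>k\<close>, so fire \<open>k\<close> itself
      burns \<open>x\<close>.\<close>
    with k obtain t where t: "ign x k = Some t"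
      unfolding k' by (auto split: option.splits simp del: ignition.simps)
    have "K < k" using k monoD[OF mono_burnings, of k K \<theta> \<Delta> \<xi> x] unfolding n_def by linarith
    moreover have "C < t"
      using n0 sum_\<xi>_le_ignition[OF t, of n0] k unfolding n_def by simp
    moreover have "0 \<le> \<theta> x (burn x k)" "0 \<le> \<Delta> x (burn x k)"
      using burnings_pos[of \<theta> \<Delta> \<xi> x k] t by (auto intro: \<theta>_nonneg \<Delta>_nonneg)
    ultimately show ?thesis unfolding good_def using t by fastforce
  qed
  define k where "k = (LEAST k. good k)"
  have k: "good k" unfolding k_def using \<open>\<exists>k. good k\<close> by (rule LeastI_ex)
  have least: "\<not> good j" if "j < k" for j using not_less_Least that unfolding k_def by blast
  obtain k' where k': "k = Suc k'" "K \<le> k'" using k by (cases k) (auto simp: good_def)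
  from k obtain t where t: "ign x (Suc k') = Some t"
    "C < t + \<theta> x (burn x (Suc k')) + \<Delta> x (burn x (Suc k'))" by (auto simp: good_def k')
  \<comment> \<open>A fire after \<open>K\<close> but before the first good one either misses
    \<open>x\<close> or has release time at most \<open>C\<close>, so the maximum stays below
    \<open>C\<close>.\<close>
  have "rel x j \<le> C" if "K \<le> j" "j \<le> k'" for j
    using that
  proof (induction rule: dec_induct)
    case (step m)
    then show ?case using least[of "Suc m"]
      by (auto simp: good_def k' Let_def split: option.split simp del: ignition.simps)
  qed (simp add: C_def)
  then have "rel x k' \<le> C" using k' by simp
  moreover have "tree (Suc x) k' \<le> C" using tree[of k'] k' by (simp add: C_def)
  \<comment> \<open>Either the candidate time is the arrival time \<open>a\<close>, or it is at most
    \<open>C\<close>, which lies below \<open>a + \<theta>\<close> by the choice of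
    \<open>k\<close>.\<close>
  ultimately have "ign (Suc x) (Suc k') \<noteq> None"
    using t unfolding ignition.simps(3) t(1) option.case Let_def
    by (auto simp: max_def simp del: burnings.simps)
  then show False using none[of "Suc k'"] k' by simp
qed

text \<open>Outer induction over sites, starting from site 0 where every fire burns; the inner
  induction gains one burning at a time by asking for a fire later than the current
  \<open>K\<close>.\<close>

lemma burnings_unbounded:
  assumes div: "\<And>x C. \<exists>n. C < (\<Sum>i=1..n. \<xi> x i)"
  shows "\<exists>k. n \<le> burn x k"
proof (induction x arbitrary: n)
  case (Suc x)
  show ?case
  proof (induction n)
    case (Suc n)
    then obtain K where K: "n \<le> burn (Suc x) K" by blast
    obtain k where k: "k > K" "ign (Suc x) k \<noteq> None"
      using burnings_unbounded_Suc[OF div \<open>\<And>n. \<exists>k. n \<le> burn x k\<close>] by blast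
    obtain k' where k': "k = Suc k'" "K \<le> k'" using k by (cases k) auto
    have "n \<le> burn (Suc x) k'" using K monoD[OF mono_burnings k'(2), of \<theta> \<Delta> \<xi> "Suc x"] by linarith
    then have "Suc n \<le> burn (Suc x) k" using k k' by (auto simp del: ignition.simps)
    then show ?case by blast
  qed simp
qed (auto simp: burnings_0)

text \<open>Before the first fire arrives at \<open>x\<close>, nothing has happened at
  \<open>x\<close> or \<open>Suc x\<close>: the release time is still 0 and the waiting tree is the
  very first one. Hence ignition takes place exactly at time \<open>t + \<Delta>\<close>.\<close>

lemma first_fire_spreads:
  assumes t: "ign x k = Some t" and first: "\<And>j. j < k \<Longrightarrow> ign x j = None"
    and \<xi>: "\<xi> (Suc x) 1 \<le> t"
  shows "ign (Suc x) k \<noteq> None"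
proof -
  obtain k' where k: "k = Suc k'" using t by (cases k) auto
  have "rel x j = 0 \<and> tree (Suc x) j = \<xi> (Suc x) 1" if "j < k" for j
    using that
  proof (induction j)
    case (Suc j)
    then have "ign x (Suc j) = None" using first by blast
    moreover from this have "ign (Suc x) (Suc j) = None" by simp
    ultimately show ?case using Suc by (simp del: ignition.simps)
  qed simp
  then have *: "rel x k' = 0" "tree (Suc x) k' = \<xi> (Suc x) 1" using k by auto
  have "0 \<le> \<Delta> x (burn x (Suc k'))"
    using burnings_pos[of \<theta> \<Delta> \<xi> x k] t unfolding k by (intro \<Delta>_nonneg) simp
  moreover have "0 \<le> t" by (rule ignition_nonneg[OF t])
  ultimately show ?thesis using t \<xi> * unfolding k
    by (auto simp: Let_def max_def simp del: burnings.simps)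
qed

text \<open>Take the first fire that reaches \<open>X\<close>. An earlier fire at some
  \<open>x \<ge> X\<close> would have passed \<open>X\<close>, so this fire is also the first one at
  each such \<open>x\<close>, and it spreads by induction.\<close>

lemma infinite_fire:
  assumes div: "\<And>x C. \<exists>n. C < (\<Sum>i=1..n. \<xi> x i)"
    and late: "\<And>x k t. X \<le> x \<Longrightarrow> ign x k = Some t \<Longrightarrow> \<xi> (Suc x) 1 \<le> t"
  shows "\<exists>k\<ge>1. rightmost_burnt \<theta> \<Delta> \<xi> k = \<infinity>"
proof -
  obtain m where "1 \<le> burn X m" using burnings_unbounded[OF div] by blast
  then have ex: "\<exists>k. ign X k \<noteq> None"
  proof (induction m)
    case (Suc m)
    then show ?case by (cases "ign X (Suc m)") (auto simp del: ignition.simps)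
  qed simp
  define k where "k = (LEAST k. ign X k \<noteq> None)"
  have k: "ign X k \<noteq> None" unfolding k_def using ex by (rule LeastI_ex)
  have first: "ign X j = None" if "j < k" for j
    using not_less_Least that unfolding k_def by blast
  have reach: "ign x k \<noteq> None" if "X \<le> x" for x
    using that
  proof (induction rule: dec_induct)
    case (step x)
    then obtain t where t: "ign x k = Some t" by blast
    show ?case
    proof (rule first_fire_spreads[OF t])
      show "ign x j = None" if "j < k" for j
        using first[OF that] ignition_downward[of \<theta> \<Delta> \<xi> x j X] step by blast
    qed (use late step t in blast)
  qed (rule k)
  have "ign x k \<noteq> None" for x
    using reach[of "max x X"] ignition_downward[of \<theta> \<Delta> \<xi> "max x X" k x] by simp
  moreover have "1 \<le> k" using k by (cases k) auto
  ultimately show ?thesis by (auto simp: rightmost_burnt_eq_infinity_iff)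
qed

text \<open>If \<open>k > L\<close>, then fire \<open>k\<close> starts late. Otherwise \<open>y \<mapsto> burnings y k\<close> is antitone with values in
  \<open>{1..L}\<close>, hence constant on one of \<open>L\<close> consecutive blocks of length \<open>L\<close>. This makes a union bound
  over deterministic indices possible, although the index of a burning is random.\<close>

lemma ignition_late:
  assumes \<xi>: "c < (\<Sum>i=1..L. \<xi> 0 i)"
    and \<Delta>: "\<And>j i. j < L \<Longrightarrow> i \<in> {1..L} \<Longrightarrow> c < (\<Sum>y\<in>{j*L..<Suc j*L}. \<Delta> y i)"
    and t: "ign x k = Some t" and x: "L * L \<le> x"
  shows "c < t"
proof (cases "k \<le> L")
  case False
  obtain t0 where "t0 \<le> t" "ign 0 k = Some t0" using ignition_0_le[OF t] by blast
  then show ?thesis using \<xi> sum_\<xi>_le_ignition[of 0 k t0 L] False by (simp add: burnings_0)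
next
  case True
  have anti: "burn z k \<le> burn y k" if "y \<le> z" for y z
    using that by (rule lift_Suc_antimono_le[of "\<lambda>y. burn y k", OF burnings_Suc_le])
  have pos: "1 \<le> burn y k" if "y \<le> x" for y
    using burnings_pos ignition_downward[OF _ that, of \<theta> \<Delta> \<xi> k] t by blast
  have le: "burn y k \<le> L" for y using anti[of 0 y] True by (simp add: burnings_0)
  \<comment> \<open>The values at the block ends \<open>j * L\<close> start at most at
    \<open>L\<close> and are still positive at \<open>j = L\<close>, since
    \<open>L * L \<le> x\<close> and fire \<open>k\<close> reaches \<open>x\<close>.\<close>
  obtain j where j: "j < L" "burn (Suc j * L) k = burn (j * L) k"
    using antitone_has_repeat[of "\<lambda>j. burn (j * L) k" L] anti le pos[OF x]
    by (metis One_nat_def Suc_le_eq add.commute le_add1 mult_Suc)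
  have jx: "Suc j * L \<le> x" using j(1) x by (meson Suc_leI mult_le_mono1 order_trans)
  have const: "burn y k = burn (j * L) k" if "y \<in> {j*L..<Suc j*L}" for y
    using anti[of "j * L" y] anti[of y "Suc j * L"] j(2) that by (simp del: mult_Suc)
  have "c < (\<Sum>y\<in>{j*L..<Suc j*L}. \<Delta> y (burn (j * L) k))"
    using j(1) le pos jx by (intro \<Delta>) auto
  also have "\<dots> = (\<Sum>y\<in>{j*L..<Suc j*L}. \<Delta> y (burn y k))"
    by (intro sum.cong refl) (metis const)
  also have "\<dots> \<le> (\<Sum>y<x. \<Delta> y (burn y k))"
    using jx by (intro sum_mono2) (auto intro!: \<Delta>_nonneg pos)
  also have "\<dots> \<le> t" by (rule sum_\<Delta>_le_ignition[OF t])
  finally show ?thesis .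
qed

end

section \<open>Measurability\<close>

text \<open>Clocks with index 0 are unconstrained, hence the form \<open>Suc i\<close>, which also
  keeps the measurability rules free of side conditions.\<close>

locale measurable_clocks =
  fixes M :: "'a measure" and \<theta>s \<Delta>s \<xi>s :: "nat \<Rightarrow> nat \<Rightarrow> 'a \<Rightarrow> real"
  assumes \<theta>s_measurable [measurable]: "\<And>x i. \<theta>s x (Suc i) \<in> borel_measurable M"
    and \<Delta>s_measurable [measurable]: "\<And>x i. \<Delta>s x (Suc i) \<in> borel_measurable M"
    and \<xi>s_measurable [measurable]: "\<And>x i. \<xi>s x (Suc i) \<in> borel_measurable M"
begin

abbreviation "ign \<omega> \<equiv> ignition (\<lambda>x i. \<theta>s x i \<omega>) (\<lambda>x i. \<Delta>s x i \<omega>) (\<lambda>x i. \<xi>s x i \<omega>)"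
abbreviation "burn \<omega> \<equiv> burnings (\<lambda>x i. \<theta>s x i \<omega>) (\<lambda>x i. \<Delta>s x i \<omega>) (\<lambda>x i. \<xi>s x i \<omega>)"
abbreviation "tree \<omega> \<equiv> next_tree (\<lambda>x i. \<theta>s x i \<omega>) (\<lambda>x i. \<Delta>s x i \<omega>) (\<lambda>x i. \<xi>s x i \<omega>)"
abbreviation "rel \<omega> \<equiv> released (\<lambda>x i. \<theta>s x i \<omega>) (\<lambda>x i. \<Delta>s x i \<omega>) (\<lambda>x i. \<xi>s x i \<omega>)"

text \<open>Measurability of an option-valued map is split into the event of the value
  \<open>None\<close> and a total real-valued map, constant on that event.\<close>

definition "measurable_ign x k \<longleftrightarrow>
  Measurable.pred M (\<lambda>\<omega>. ign \<omega> x k = None) \<and> (\<lambda>\<omega>. the (ign \<omega> x k)) \<in> borel_measurable M"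

definition "measurable_past x k \<longleftrightarrow>
  (\<lambda>\<omega>. burn \<omega> x k) \<in> measurable M (count_space UNIV) \<and>
  (\<lambda>\<omega>. tree \<omega> x k) \<in> borel_measurable M \<and> (\<lambda>\<omega>. rel \<omega> x k) \<in> borel_measurable M"

text \<open>The random index takes countably many values, so the space splits into countably many
  events on which it is fixed.\<close>

lemma measurable_clock_at_burnings:
  assumes "measurable_past x k"
  shows "(\<lambda>\<omega>. \<theta>s x (Suc (burn \<omega> x k)) \<omega>) \<in> borel_measurable M"
    and "(\<lambda>\<omega>. \<Delta>s x (Suc (burn \<omega> x k)) \<omega>) \<in> borel_measurable M"
    and "(\<lambda>\<omega>. \<xi>s x (Suc (Suc (burn \<omega> x k))) \<omega>) \<in> borel_measurable M"
proof -
  have b: "(\<lambda>\<omega>. burn \<omega> x k) \<in> measurable M (count_space UNIV)"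
    using assms by (simp add: measurable_past_def)
  show "(\<lambda>\<omega>. \<theta>s x (Suc (burn \<omega> x k)) \<omega>) \<in> borel_measurable M"
    "(\<lambda>\<omega>. \<Delta>s x (Suc (burn \<omega> x k)) \<omega>) \<in> borel_measurable M"
    "(\<lambda>\<omega>. \<xi>s x (Suc (Suc (burn \<omega> x k))) \<omega>) \<in> borel_measurable M"
    by (rule measurable_compose_countable[OF _ b], measurable)+
qed

lemma measurable_past_Suc:
  assumes I: "measurable_ign x (Suc k)" and P: "measurable_past x k"
  shows "measurable_past x (Suc k)"
proof -
  note [measurable] = measurable_clock_at_burnings[OF P]
    P[unfolded measurable_past_def, THEN conjunct1]
    P[unfolded measurable_past_def, THEN conjunct2, THEN conjunct1]
    P[unfolded measurable_past_def, THEN conjunct2, THEN conjunct2]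
    I[unfolded measurable_ign_def, THEN conjunct1]
    I[unfolded measurable_ign_def, THEN conjunct2]
  have eq: "(\<lambda>\<omega>. burn \<omega> x (Suc k)) =
      (\<lambda>\<omega>. if ign \<omega> x (Suc k) = None then burn \<omega> x k else Suc (burn \<omega> x k))"
    "(\<lambda>\<omega>. tree \<omega> x (Suc k)) =
      (\<lambda>\<omega>. if ign \<omega> x (Suc k) = None then tree \<omega> x k
        else the (ign \<omega> x (Suc k)) + \<theta>s x (Suc (burn \<omega> x k)) \<omega> + \<xi>s x (Suc (Suc (burn \<omega> x k))) \<omega>)"
    "(\<lambda>\<omega>. rel \<omega> x (Suc k)) =
      (\<lambda>\<omega>. if ign \<omega> x (Suc k) = None then rel \<omega> x k
        else max (rel \<omega> x k) (the (ign \<omega> x (Suc k)) + \<theta>s x (Suc (burn \<omega> x k)) \<omega>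
          + \<Delta>s x (Suc (burn \<omega> x k)) \<omega>))"
    by (auto split: option.split simp: fun_eq_iff simp del: ignition.simps)
  show ?thesis unfolding measurable_past_def eq by measurable
qed

lemma measurable_ign_Suc:
  assumes I: "measurable_ign x (Suc k)" and P: "measurable_past x k" and Q: "measurable_past (Suc x) k"
  shows "measurable_ign (Suc x) (Suc k)"
proof -
  note [measurable] = measurable_clock_at_burnings[OF P]
    P[unfolded measurable_past_def, THEN conjunct2, THEN conjunct2]
    Q[unfolded measurable_past_def, THEN conjunct2, THEN conjunct1]
    I[unfolded measurable_ign_def, THEN conjunct1]
    I[unfolded measurable_ign_def, THEN conjunct2]
  \<comment> \<open>Where fire \<open>Suc k\<close> misses \<open>x\<close>, the value of
    \<open>a\<close> comes from the default \<open>the None\<close>; \<open>reach\<close> is false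
    there, so this does no harm.\<close>
  define a where "a \<omega> = the (ign \<omega> x (Suc k)) + \<Delta>s x (Suc (burn \<omega> x k)) \<omega>" for \<omega>
  define s where "s \<omega> = max (a \<omega>) (max (rel \<omega> x k) (tree \<omega> (Suc x) k))" for \<omega>
  define reach where "reach \<omega> \<longleftrightarrow> ign \<omega> x (Suc k) \<noteq> None \<and>
    (s \<omega> = a \<omega> \<or> s \<omega> < a \<omega> + \<theta>s x (Suc (burn \<omega> x k)) \<omega>)" for \<omega>
  have [measurable]: "a \<in> borel_measurable M" unfolding a_def by measurable
  have [measurable]: "s \<in> borel_measurable M" unfolding s_def by measurable
  have [measurable]: "Measurable.pred M reach" unfolding reach_def by measurable
  have eq: "ign \<omega> (Suc x) (Suc k) = (if reach \<omega> then Some (s \<omega>) else None)" for \<omega>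
    unfolding reach_def s_def a_def ignition.simps(3) burnings.simps(2) Let_def
    by (auto split: option.split simp del: ignition.simps)
  have 1: "(\<lambda>\<omega>. ign \<omega> (Suc x) (Suc k) = None) = (\<lambda>\<omega>. \<not> reach \<omega>)"
    and 2: "(\<lambda>\<omega>. the (ign \<omega> (Suc x) (Suc k))) = (\<lambda>\<omega>. if reach \<omega> then s \<omega> else the None)"
    by (auto simp: fun_eq_iff eq simp del: ignition.simps)
  show ?thesis unfolding measurable_ign_def 1 2 by measurable
qed

text \<open>The order of induction follows the recursion: fire \<open>Suc k\<close> at
  \<open>Suc x\<close> depends on the same fire at \<open>x\<close> and on the state left at both
  sites by the first \<open>k\<close> fires.\<close>

lemma measurable_ign: "measurable_ign x k"
  and measurable_past: "measurable_past x k"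
proof -
  have base: "measurable_ign x 0" "measurable_past x 0" for x
    by (simp_all add: measurable_ign_def measurable_past_def)
  have "measurable_ign x k \<and> measurable_past x k"
  proof (induction x arbitrary: k)
    case 0
    show ?case
    proof (induction k)
      case (Suc k)
      then have "measurable_ign 0 (Suc k)"
        by (simp add: measurable_ign_def measurable_past_def del: next_tree.simps)
      with Suc show ?case by (blast intro: measurable_past_Suc)
    qed (simp add: base)
  next
    case (Suc x)
    show ?case
    proof (induction k)
      case (Suc k)
      then show ?case
        using measurable_ign_Suc[of x k] \<open>\<And>k. measurable_ign x k \<and> measurable_past x k\<close>
        by (blast intro: measurable_past_Suc)
    qed (simp add: base)
  qed
  then show "measurable_ign x k" "measurable_past x k" by auto
qed

lemma pred_ignition [measurable]: "Measurable.pred M (\<lambda>\<omega>. ign \<omega> x k = None)"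
  using measurable_ign by (simp add: measurable_ign_def)

end

section \<open>Probability estimates\<close>

text \<open>Chernoff bound: the indicator of the event is at most \<open>exp (a - S)\<close> for the
  sum \<open>S\<close>, and independence factorizes the expectation. The map \<open>g\<close>
  selects the subfamily to be summed.\<close>

lemma (in prob_space) prob_sum_le_exp:
  assumes "finite I" and inj: "inj_on g I" and indep: "indep_vars (\<lambda>_. borel) X (g ` I)"
    and q: "\<And>i. i \<in> I \<Longrightarrow> (\<integral>\<^sup>+\<omega>. ennreal (exp (- X (g i) \<omega>)) \<partial>M) \<le> ennreal q" and "0 \<le> q"
  shows "prob {\<omega>\<in>space M. (\<Sum>i\<in>I. X (g i) \<omega>) \<le> a} \<le> exp a * q ^ card I"
proof -
  let ?A = "{\<omega>\<in>space M. (\<Sum>i\<in>I. X (g i) \<omega>) \<le> a}"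
  have X [measurable]: "X (g i) \<in> borel_measurable M" if "i \<in> I" for i
    using indep that by (auto simp: indep_vars_def)
  have [measurable]: "?A \<in> sets M" by measurable
  have "emeasure M ?A = (\<integral>\<^sup>+\<omega>. indicator ?A \<omega> \<partial>M)" by simp
  also have "\<dots> \<le> (\<integral>\<^sup>+\<omega>. ennreal (exp a) * (\<Prod>j\<in>g ` I. ennreal (exp (- X j \<omega>))) \<partial>M)"
  proof (intro nn_integral_mono)
    fix \<omega>
    have "(\<Prod>j\<in>g ` I. ennreal (exp (- X j \<omega>))) = ennreal (exp (- (\<Sum>i\<in>I. X (g i) \<omega>)))"
      using inj \<open>finite I\<close>
      by (simp add: prod.reindex prod_ennreal exp_sum flip: sum_negf)
    then have "ennreal (exp a) * (\<Prod>j\<in>g ` I. ennreal (exp (- X j \<omega>))) =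
        ennreal (exp (a - (\<Sum>i\<in>I. X (g i) \<omega>)))"
      by (simp add: exp_diff exp_minus field_simps flip: ennreal_mult)
    then show "indicator ?A \<omega> \<le> ennreal (exp a) * (\<Prod>j\<in>g ` I. ennreal (exp (- X j \<omega>)))"
      by (auto simp: indicator_def)
  qed
  also have "\<dots> = ennreal (exp a) * (\<integral>\<^sup>+\<omega>. (\<Prod>j\<in>g ` I. ennreal (exp (- X j \<omega>))) \<partial>M)"
    using X by (intro nn_integral_cmult borel_measurable_prod_ennreal) auto
  also have "(\<integral>\<^sup>+\<omega>. (\<Prod>j\<in>g ` I. ennreal (exp (- X j \<omega>))) \<partial>M) =
      (\<Prod>j\<in>g ` I. \<integral>\<^sup>+\<omega>. ennreal (exp (- X j \<omega>)) \<partial>M)"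
    using \<open>finite I\<close>
    by (intro indep_vars_nn_integral indep_vars_compose2[OF indep]) auto
  also have "\<dots> \<le> (\<Prod>i\<in>I. ennreal q)"
    unfolding prod.reindex[OF inj] o_def using q by (intro prod_mono_ennreal)
  also have "ennreal (exp a) * (\<Prod>i\<in>I. ennreal q) = ennreal (exp a * q ^ card I)"
    using \<open>0 \<le> q\<close> by (simp add: ennreal_power ennreal_mult)
  finally show ?thesis
    using \<open>0 \<le> q\<close> by (simp add: emeasure_eq_measure mult_left_mono)
qed

text \<open>The integrand is at most 1 almost surely and strictly below 1 with positive probability.
  Applied to \<open>\<Delta>\<close>, this is where positivity of the spreading time enters.\<close>

lemma (in prob_space) nn_integral_exp_minus_less_1:
  assumes [measurable]: "X \<in> borel_measurable M" and nonneg: "AE \<omega> in M. 0 \<le> X \<omega>"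
    and pos: "\<P>(\<omega> in M. 0 < X \<omega>) > 0"
  obtains q where "q < 1" "(\<integral>\<^sup>+\<omega>. ennreal (exp (- X \<omega>)) \<partial>M) = ennreal q"
proof
  have int: "integrable M (\<lambda>\<omega>. exp (- X \<omega>))"
    by (rule integrable_const_bound[of _ 1]) (use nonneg in auto)
  show "(\<integral>\<^sup>+\<omega>. ennreal (exp (- X \<omega>)) \<partial>M) = ennreal (\<integral>\<omega>. exp (- X \<omega>) \<partial>M)"
    by (intro nn_integral_eq_integral int) auto
  have "(\<integral>\<omega>. exp (- X \<omega>) \<partial>M) < (\<integral>\<omega>. 1 \<partial>M)"
    by (rule integral_less_AE[where A="{\<omega>\<in>space M. 0 < X \<omega>}"])
      (use int nonneg pos in \<open>auto simp: emeasure_eq_measure\<close>)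
  then show "(\<integral>\<omega>. exp (- X \<omega>) \<partial>M) < 1" by (simp add: prob_space)
qed

text \<open>Borel-Cantelli; the factor \<open>(Suc L)\<^sup>2\<close> leaves room for the union
  bounds over blocks and sites.\<close>

lemma (in prob_space) AE_eventually_not_of_exp_bound:
  assumes "\<And>L. B L \<in> events" and "0 < c"
    and le: "\<And>L. prob (B L) \<le> real ((Suc L)\<^sup>2) * exp (- c * real L)"
  shows "AE \<omega> in M. eventually (\<lambda>L. \<omega> \<notin> B L) sequentially"
proof -
  have "(\<lambda>L. real ((Suc L)\<^sup>2) * exp (- c * real L)) \<in> O(\<lambda>L. inverse (real L ^ 2))"
    using \<open>0 < c\<close> by real_asymp
  then have "summable (\<lambda>L. real ((Suc L)\<^sup>2) * exp (- c * real L))"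
    by (rule summable_comparison_test_bigo[rotated]) (use inverse_power_summable[of 2] in auto)
  then have "summable (\<lambda>L. prob (B L))"
    by (rule summable_comparison_test') (use le in auto)
  then have "AE \<omega> in M. eventually (\<lambda>L. \<omega> \<in> space M - B L) sequentially"
    using assms(1) by (intro borel_cantelli_AE1) (auto simp: less_top[symmetric])
  then show ?thesis by (auto elim!: eventually_mono)
qed

section \<open>Almost sure behaviour and exponential bounds for the clocks of the model\<close>

context forest_fire
begin

definition clock :: "clock_kind \<times> nat \<times> nat \<Rightarrow> 'a \<Rightarrow> real" where
  "clock = (\<lambda>(c, x, i). case c of Burning \<Rightarrow> \<theta>s x i | Spreading \<Rightarrow> \<Delta>s x i | Growing \<Rightarrow> \<xi>s x i)"

lemma clock_simps [simp]:
  "clock (Burning, x, i) = \<theta>s x i" "clock (Spreading, x, i) = \<Delta>s x i"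
  "clock (Growing, x, i) = \<xi>s x i"
  by (simp_all add: clock_def)

lemma indep_clock: "indep_vars (\<lambda>_. borel) clock (UNIV \<times> UNIV \<times> {1..})"
  using indep by (simp add: clock_def)

lemma clock_measurable: "1 \<le> i \<Longrightarrow> clock (c, x, i) \<in> borel_measurable M"
  using indep_clock by (auto simp: indep_vars_def)

lemma clocks_measurable:
  assumes "1 \<le> i"
  shows "\<theta>s x i \<in> borel_measurable M" "\<Delta>s x i \<in> borel_measurable M" "\<xi>s x i \<in> borel_measurable M"
  using clock_measurable[OF assms, of Burning x] clock_measurable[OF assms, of Spreading x]
    clock_measurable[OF assms, of Growing x] by simp_all

lemma AE_\<xi>s_pos:
  assumes i: "1 \<le> i"
  shows "AE \<omega> in M. 0 < \<xi>s x i \<omega>"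
proof -
  note [measurable] = clocks_measurable[OF i]
  have "prob {\<omega>\<in>space M. 0 < \<xi>s x i \<omega>} = 1"
    using exponential_distributedD_gt[OF \<xi>s_distr[OF i], of 0] by simp
  then show ?thesis by (subst (asm) prob_Collect_eq_1) simp_all
qed

lemma AE_nonneg_clocks:
  "AE \<omega> in M. nonneg_clocks (\<lambda>x i. \<theta>s x i \<omega>) (\<lambda>x i. \<Delta>s x i \<omega>) (\<lambda>x i. \<xi>s x i \<omega>)"
proof -
  have "AE \<omega> in M. 1 \<le> i \<longrightarrow> 0 \<le> \<theta>s x i \<omega> \<and> 0 \<le> \<Delta>s x i \<omega> \<and> 0 \<le> \<xi>s x i \<omega>" for x i
  proof (cases "1 \<le> i")
    case i: True
    note [measurable] = clocks_measurable[OF i] \<theta>_measurable \<Delta>_measurable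
    have "AE y in distr M borel (\<theta>s x i). 0 \<le> y"
      unfolding \<theta>s_distr[OF i] by (subst AE_distr_iff) (use \<theta>_nonneg in auto)
    then have "AE \<omega> in M. 0 \<le> \<theta>s x i \<omega>" by (subst (asm) AE_distr_iff) auto
    moreover have "AE y in distr M borel (\<Delta>s x i). 0 \<le> y"
      unfolding \<Delta>s_distr[OF i] by (subst AE_distr_iff) (use \<Delta>_nonneg in auto)
    then have "AE \<omega> in M. 0 \<le> \<Delta>s x i \<omega>" by (subst (asm) AE_distr_iff) auto
    ultimately show ?thesis using AE_\<xi>s_pos[OF i, of x] by eventually_elim auto
  qed simp
  then have "AE \<omega> in M. \<forall>x i. 1 \<le> i \<longrightarrow> 0 \<le> \<theta>s x i \<omega> \<and> 0 \<le> \<Delta>s x i \<omega> \<and> 0 \<le> \<xi>s x i \<omega>"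
    by (simp add: AE_all_countable)
  then show ?thesis by eventually_elim (simp add: nonneg_clocks_def)
qed

text \<open>One rate serves both kinds of clocks. The exponent is \<open>2 * c\<close> because the
  Chernoff bound at level \<open>c\<close> per summand costs half of it.\<close>

lemma exp_moment_bound:
  assumes "\<P>(\<omega> in N. 0 < \<Delta> \<omega>) > 0"
  obtains c where "0 < c" and
    "\<And>p. p \<in> {Spreading, Growing} \<times> UNIV \<times> {1..} \<Longrightarrow>
      (\<integral>\<^sup>+\<omega>. ennreal (exp (- clock p \<omega>)) \<partial>M) \<le> ennreal (exp (- 2 * c))"
proof -
  note [measurable] = \<Delta>_measurable clocks_measurable
  obtain q where q: "q < 1" "(\<integral>\<^sup>+\<omega>. ennreal (exp (- \<Delta> \<omega>)) \<partial>N) = ennreal q"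
    using prob_space.nn_integral_exp_minus_less_1[OF N \<Delta>_measurable \<Delta>_nonneg assms] by blast
  have "AE \<omega> in M. 0 \<le> \<xi>s 0 1 \<omega>" using AE_\<xi>s_pos[of 1 0] by auto
  moreover have "prob {\<omega>\<in>space M. 0 < \<xi>s 0 1 \<omega>} > 0"
    using exponential_distributedD_gt[OF \<xi>s_distr, of 1 0 0] by simp
  ultimately obtain q' where
    q': "q' < 1" "(\<integral>\<^sup>+\<omega>. ennreal (exp (- \<xi>s 0 1 \<omega>)) \<partial>M) = ennreal q'"
    using nn_integral_exp_minus_less_1[of "\<xi>s 0 1"] clocks_measurable by (metis order_refl)
  \<comment> \<open>The lower bound \<open>1/2\<close> guarantees a positive argument for
    \<open>ln\<close>.\<close>
  define r where "r = max (1/2) (max q q')"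
  define c where "c = - ln r / 2"
  have r: "0 < r" "r < 1" using q q' by (auto simp: r_def)
  have exp_c: "exp (- 2 * c) = r" using r by (simp add: c_def)
  show ?thesis
  proof
    show "0 < c" using r by (simp add: c_def)
    fix p :: "clock_kind \<times> nat \<times> nat"
    assume p: "p \<in> {Spreading, Growing} \<times> UNIV \<times> {1..}"
    then obtain x i where xi: "1 \<le> i" "p = (Spreading, x, i) \<or> p = (Growing, x, i)" by auto
    note [measurable] = clocks_measurable[OF xi(1)]
    have "(\<integral>\<^sup>+\<omega>. ennreal (exp (- \<Delta>s x i \<omega>)) \<partial>M) =
        (\<integral>\<^sup>+y. ennreal (exp (- y)) \<partial>distr M borel (\<Delta>s x i))"
      by (simp add: nn_integral_distr)
    also have "\<dots> = ennreal q"
      unfolding \<Delta>s_distr[OF xi(1)] by (simp add: nn_integral_distr q)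
    finally have \<Delta>: "(\<integral>\<^sup>+\<omega>. ennreal (exp (- \<Delta>s x i \<omega>)) \<partial>M) = ennreal q" .
    have "(\<integral>\<^sup>+\<omega>. ennreal (exp (- \<xi>s x i \<omega>)) \<partial>M) =
        (\<integral>\<^sup>+y. exponential_density 1 y * ennreal (exp (- y)) \<partial>lborel)"
      by (rule distributed_nn_integral[OF \<xi>s_distr[OF xi(1)], symmetric]) simp
    also have "\<dots> = (\<integral>\<^sup>+\<omega>. ennreal (exp (- \<xi>s 0 1 \<omega>)) \<partial>M)"
      by (rule distributed_nn_integral[OF \<xi>s_distr]) simp_all
    finally have \<xi>: "(\<integral>\<^sup>+\<omega>. ennreal (exp (- \<xi>s x i \<omega>)) \<partial>M) = ennreal q'" using q' by simp
    show "(\<integral>\<^sup>+\<omega>. ennreal (exp (- clock p \<omega>)) \<partial>M) \<le> ennreal (exp (- 2 * c))"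
      unfolding exp_c using xi(2) \<Delta> \<xi> by (auto simp: r_def intro!: ennreal_leI)
  qed
qed

lemma prob_sum_clock_le:
  assumes mom: "\<And>p. p \<in> {Spreading, Growing} \<times> UNIV \<times> {1..} \<Longrightarrow>
      (\<integral>\<^sup>+\<omega>. ennreal (exp (- clock p \<omega>)) \<partial>M) \<le> ennreal (exp (- 2 * c))"
    and "finite I" "inj_on g I" and g: "g ` I \<subseteq> {Spreading, Growing} \<times> UNIV \<times> {1..}"
  shows "prob {\<omega>\<in>space M. (\<Sum>i\<in>I. clock (g i) \<omega>) \<le> c * card I} \<le> exp (- c * card I)"
proof -
  have "prob {\<omega>\<in>space M. (\<Sum>i\<in>I. clock (g i) \<omega>) \<le> c * card I} \<le>
      exp (c * card I) * exp (- 2 * c) ^ card I"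
    using g by (intro prob_sum_le_exp assms indep_vars_subset[OF indep_clock]) auto
  also have "\<dots> = exp (- c * card I)"
    by (simp add: exp_of_nat_mult[symmetric] exp_add[symmetric] algebra_simps)
  finally show ?thesis .
qed

lemma AE_infinite_fire:
  assumes "\<P>(\<omega> in N. 0 < \<Delta> \<omega>) > 0"
  shows "AE \<omega> in M. \<exists>k\<ge>1.
    rightmost_burnt (\<lambda>x i. \<theta>s x i \<omega>) (\<lambda>x i. \<Delta>s x i \<omega>) (\<lambda>x i. \<xi>s x i \<omega>) k = \<infinity>"
proof -
  note [measurable] = clocks_measurable
  obtain c where c: "0 < c" and mom: "\<And>p. p \<in> {Spreading, Growing} \<times> UNIV \<times> {1..} \<Longrightarrow>
      (\<integral>\<^sup>+\<omega>. ennreal (exp (- clock p \<omega>)) \<partial>M) \<le> ennreal (exp (- 2 * c))"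
    using exp_moment_bound[OF assms] by blast

  \<comment> \<open>Bad events at scale \<open>L\<close>, all with threshold \<open>c * L\<close>.
    Outside the first two, no fire reaches a site \<open>x \<ge> L * L\<close> by time
    \<open>c * L\<close>; outside the third, the first trees have grown by then.
    \<open>slow_growth\<close> at general \<open>x\<close> also yields the divergence of growth
    times.\<close>
  define slow_growth where
    "slow_growth x L = {\<omega>\<in>space M. (\<Sum>i=1..L. \<xi>s x i \<omega>) \<le> c * L}" for x L :: nat
  define fast_block where
    "fast_block L = (\<lambda>(j, i). {\<omega>\<in>space M. (\<Sum>y\<in>{j*L..<Suc j*L}. \<Delta>s y i \<omega>) \<le> c * L})" for L :: nat
  define late_tree where
    "late_tree L x = {\<omega>\<in>space M. c * L < \<xi>s (Suc x) 1 \<omega>}" for L x :: nat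
  have [measurable]: "slow_growth x L \<in> events" "late_tree L x \<in> events" for x L
    unfolding slow_growth_def late_tree_def by measurable
  have fast_sets: "fast_block L p \<in> events" if "p \<in> {..<L} \<times> {1..L}" for L p
    using that unfolding fast_block_def by auto
  have le_poly: "exp (- c * L) * real n \<le> real ((Suc L)\<^sup>2) * exp (- c * L)" if "n \<le> (Suc L)\<^sup>2" for L n
    using that by (subst mult.commute) (intro mult_right_mono, auto simp del: of_nat_power)

  have 1: "AE \<omega> in M. \<forall>x. eventually (\<lambda>L. \<omega> \<notin> slow_growth x L) sequentially"
    unfolding AE_all_countable
  proof (intro allI AE_eventually_not_of_exp_bound[OF _ c])
    fix x L
    have "prob (slow_growth x L) \<le> exp (- c * L)"
      using prob_sum_clock_le[OF mom, of "{1..L}" "\<lambda>i. (Growing, x, i)"]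
      by (auto simp: slow_growth_def inj_on_def image_subset_iff)
    also have "\<dots> \<le> real ((Suc L)\<^sup>2) * exp (- c * L)" using le_poly[of 1 L] by simp
    finally show "prob (slow_growth x L) \<le> real ((Suc L)\<^sup>2) * exp (- c * L)" .
  qed simp
  have 2: "AE \<omega> in M. eventually (\<lambda>L. \<omega> \<notin> (\<Union>p\<in>{..<L} \<times> {1..L}. fast_block L p)) sequentially"
  proof (rule AE_eventually_not_of_exp_bound[OF _ c])
    show "(\<Union>p\<in>{..<L} \<times> {1..L}. fast_block L p) \<in> events" for L
      using fast_sets by (intro sets.finite_UN) auto
    fix L
    have "prob (fast_block L p) \<le> exp (- c * L)" if "p \<in> {..<L} \<times> {1..L}" for p
    proof -
      obtain j i where p: "p = (j, i)" "1 \<le> i" using \<open>p \<in> _\<close> by auto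
      show ?thesis
        using prob_sum_clock_le[OF mom, of "{j*L..<Suc j*L}" "\<lambda>y. (Spreading, y, i)"] p
        by (auto simp: fast_block_def inj_on_def image_subset_iff)
    qed
    then have "prob (\<Union>p\<in>{..<L} \<times> {1..L}. fast_block L p) \<le> (\<Sum>p\<in>{..<L} \<times> {1..L}. exp (- c * L))"
      using fast_sets
      by (intro order_trans[OF measure_UNION_le] sum_mono) auto
    also have "\<dots> \<le> real ((Suc L)\<^sup>2) * exp (- c * L)"
      using le_poly[of "L * L" L] by (simp add: power2_eq_square algebra_simps)
    finally show "prob (\<Union>p\<in>{..<L} \<times> {1..L}. fast_block L p) \<le> real ((Suc L)\<^sup>2) * exp (- c * L)" .
  qed
  \<comment> \<open>The range \<open>x < (Suc L)\<^sup>2\<close> contains every site whose integer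
    square root is \<open>L\<close>.\<close>
  have 3: "AE \<omega> in M. eventually (\<lambda>L. \<omega> \<notin> (\<Union>x<(Suc L)\<^sup>2. late_tree L x)) sequentially"
  proof (rule AE_eventually_not_of_exp_bound[OF _ c])
    show "(\<Union>x<(Suc L)\<^sup>2. late_tree L x) \<in> events" for L by measurable
    fix L
    have "prob (late_tree L x) = exp (- c * L)" for x
      using exponential_distributedD_gt[OF \<xi>s_distr, of 1 "c * L" "Suc x"] c
      by (simp add: late_tree_def)
    then have "prob (\<Union>x<(Suc L)\<^sup>2. late_tree L x) \<le> (\<Sum>x<(Suc L)\<^sup>2. exp (- c * L))"
      by (intro order_trans[OF measure_UNION_le] sum_mono) auto
    then show "prob (\<Union>x<(Suc L)\<^sup>2. late_tree L x) \<le> real ((Suc L)\<^sup>2) * exp (- c * L)"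
      by (simp del: of_nat_power)
  qed

  from AE_nonneg_clocks 1 2 3 AE_space show ?thesis
  proof eventually_elim
    case (elim \<omega>)
    interpret nonneg_clocks "\<lambda>x i. \<theta>s x i \<omega>" "\<lambda>x i. \<Delta>s x i \<omega>" "\<lambda>x i. \<xi>s x i \<omega>"
      by (rule elim(1))
    have "eventually (\<lambda>L. \<omega> \<notin> slow_growth 0 L \<and>
        \<omega> \<notin> (\<Union>p\<in>{..<L} \<times> {1..L}. fast_block L p) \<and> \<omega> \<notin> (\<Union>x<(Suc L)\<^sup>2. late_tree L x)) sequentially"
      using elim by (intro eventually_conj) blast+
    then obtain L0 where L0: "\<And>L. L0 \<le> L \<Longrightarrow> \<omega> \<notin> slow_growth 0 L \<and>
        \<omega> \<notin> (\<Union>p\<in>{..<L} \<times> {1..L}. fast_block L p) \<and> \<omega> \<notin> (\<Union>x<(Suc L)\<^sup>2. late_tree L x)"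
      by (auto simp: eventually_sequentially)
    show ?case
    proof (rule infinite_fire)
      fix x and C :: real
      have "eventually (\<lambda>L. C / c < real L) sequentially"
        using filterlim_real_sequentially by (simp add: filterlim_at_top_dense)
      then have "eventually (\<lambda>L. C / c < real L \<and> \<omega> \<notin> slow_growth x L) sequentially"
        using elim by (intro eventually_conj) blast+
      then obtain L where "C / c < real L" "\<omega> \<notin> slow_growth x L"
        by (auto simp: eventually_sequentially)
      then have "C < (\<Sum>i=1..L. \<xi>s x i \<omega>)"
        using c elim by (auto simp: slow_growth_def field_simps)
      then show "\<exists>n. C < (\<Sum>i=1..n. \<xi>s x i \<omega>)" by blast
    next
      fix x k t
      assume x: "L0\<^sup>2 \<le> x" and t: "ign x k = Some t"
      \<comment> \<open>This scale fits both needs: \<open>L\<close> blocks of length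
        \<open>L\<close> lie before \<open>x\<close>, and \<open>x\<close> is in the range covered
        by \<open>late_tree L\<close>. Moreover \<open>L0\<^sup>2 \<le> x\<close> gives
        \<open>L0 \<le> L\<close>.\<close>
      define L where "L = floor_sqrt x"
      have L: "L0 \<le> L" "L * L \<le> x" "x < (Suc L)\<^sup>2"
        using x floor_sqrt_power2_le[of x] Suc_floor_sqrt_power2_gt[of x]
        by (auto simp: L_def le_floor_sqrt_iff power2_eq_square)
      have "c * L < t"
      proof (rule ignition_late[OF _ _ t L(2)])
        show "c * L < (\<Sum>i=1..L. \<xi>s 0 i \<omega>)"
          using L0[OF L(1)] elim by (auto simp: slow_growth_def not_le)
        show "c * L < (\<Sum>y\<in>{j*L..<Suc j*L}. \<Delta>s y i \<omega>)" if "j < L" "i \<in> {1..L}" for j i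
          using L0[OF L(1)] elim that by (fastforce simp: fast_block_def not_le)
      qed
      moreover have "\<xi>s (Suc x) 1 \<omega> \<le> c * L"
        using L0[OF L(1)] elim L(3) by (fastforce simp: late_tree_def not_less)
      ultimately show "\<xi>s (Suc x) 1 \<omega> \<le> t" by simp
    qed
  qed
qed

end

text \<open>The infimum of the empty set is \<open>\<infinity>\<close>, and any element bounds the
  infimum by a finite number.\<close>

lemma INF_enat_less_infinity_iff: "(INF k\<in>A. enat k) < \<infinity> \<longleftrightarrow> A \<noteq> {}"
  unfolding INF_less_iff by auto

theorem theorem2p1:
  fixes M :: "'a measure" and N :: "'b measure"
    and \<theta> \<Delta> :: "'b \<Rightarrow> real"
    and \<theta>s \<Delta>s \<xi>s :: "nat \<Rightarrow> nat \<Rightarrow> 'a \<Rightarrow> real"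
  assumes "forest_fire M N \<theta> \<Delta> \<theta>s \<Delta>s \<xi>s"
    and "\<P>(\<omega> in N. 0 < \<Delta> \<omega>) > 0"
  defines "n \<equiv> \<lambda>k \<omega>. rightmost_burnt (\<lambda>x i. \<theta>s x i \<omega>) (\<lambda>x i. \<Delta>s x i \<omega>) (\<lambda>x i. \<xi>s x i \<omega>) k"
  shows "\<P>(\<omega> in M. (INF k\<in>{k. 1 \<le> k \<and> n k \<omega> = \<infinity>}. enat k) < \<infinity>) = 1"
proof -
  interpret forest_fire M N \<theta> \<Delta> \<theta>s \<Delta>s \<xi>s by fact
  interpret measurable_clocks M \<theta>s \<Delta>s \<xi>s
    by unfold_locales (simp_all add: clocks_measurable)
  \<comment> \<open>The event becomes a countable combination of measurable ones; its measurability
    is needed to pass from an almost sure statement to probability 1.\<close>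
  have eq: "(INF k\<in>{k. 1 \<le> k \<and> n k \<omega> = \<infinity>}. enat k) < \<infinity> \<longleftrightarrow>
      (\<exists>k. 1 \<le> k \<and> (\<forall>x. ign \<omega> x k \<noteq> None))" for \<omega>
    unfolding INF_enat_less_infinity_iff n_def rightmost_burnt_eq_infinity_iff by blast
  have "{\<omega>\<in>space M. \<exists>k. 1 \<le> k \<and> (\<forall>x. ign \<omega> x k \<noteq> None)} \<in> events" by measurable
  then show ?thesis
    unfolding eq using AE_infinite_fire[OF assms(2)]
    by (subst prob_Collect_eq_1) (simp_all only: rightmost_burnt_eq_infinity_iff)
qed

end
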